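(* Let $n\geq 1$ be an integer and let $\alpha,\beta\in\mathbf{C}$. Every meromorphic solution $f$ on $\mathbf{C}$ of the differential equation $$f^n(z)+\left(f'\right)^n(z)=e^{\alpha z+\beta}$$ is entire, and the solutions are described as follows. (A) When $n=1$: if $\alpha\neq-1$, the general solutions are $f(z)=\frac{e^{\alpha z+\beta}}{\alpha+1}+ae^{-z}$ with $a\in\mathbf{C}$; if $\alpha=-1$, the general solutions are $f(z)=ze^{-z+\beta}+ae^{-z}$ with $a\in\mathbf{C}$. (B) When $n=2$: either $\alpha=0$ and the general solutions are $f(z)=e^{\frac{\beta}{2}}\sin(z+b)$ with $b\in\mathbf{C}$, or $f(z)=de^{\frac{\alpha z+\beta}{2}}$ with $d\in\mathbf{C}$ satisfying $d^2\left(1+\left(\frac{\alpha}{2}\right)^2\right)=1$. (C) When $n\geq3$: the general solutions are $f(z)=de^{\frac{\alpha z+\beta}{n}}$ with $d\in\mathbf{C}$ satisfying $d^n\left(1+\left(\frac{\alpha}{n}\right)^n\right)=1$.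
   Context: Here $f^n$ and $(f')^n$ denote $n$-th powers (not iterates or higher derivatives). Solutions are understood to be functions meromorphic in the whole complex plane $\mathbf{C}$. "The general solutions are ..." means that the meromorphic solutions of the equation are exactly the functions of the displayed form, with the parameters ranging over all complex numbers subject to the stated constraints. In (B), the meaning is that the set of solutions consists of the functions $de^{(\alpha z+\beta)/2}$ with $d$ as stated, together with, only if $\alpha=0$, the functions $e^{\beta/2}\sin(z+b)$. For some $\alpha$ no admissible $d$ exists, namely when $1+(\alpha/n)^n=0$; then there are no solutions of the form $de^{(\alpha z+\beta)/n}$. *)

theory Defs
  imports "HOL-Complex_Analysis.Complex_Analysis"
begin

(* A meromorphic function on the complex plane is represented by the total function that agrees
   with it off its poles and takes the dummy value 0 at them (nicely_meromorphic_on); thus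
   removable singularities are filled in and distinct functions in HOL are distinct meromorphic
   functions.  The values of f and deriv f at a pole are meaningless, so the equation is imposed
   at all other points. *)
definition meromorphic_solution ::
    "nat \<Rightarrow> complex \<Rightarrow> complex \<Rightarrow> (complex \<Rightarrow> complex) \<Rightarrow> bool" where
  "meromorphic_solution n \<alpha> \<beta> f \<longleftrightarrow>
     f nicely_meromorphic_on UNIV \<and>
     (\<forall>z. \<not> is_pole f z \<longrightarrow> f z ^ n + deriv f z ^ n = exp (\<alpha> * z + \<beta>))"

end

theory Submission
  imports Defs
begin

text \<open>
  The right-hand side is bounded near every point, so near a pole of \<open>f\<close> the equation forces
  \<open>(f'/f)^n\<close> to be close to \<open>-1\<close>; but the logarithmic derivative \<open>f'/f\<close> is unbounded there.  Hence
  solutions are entire.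

  For \<open>n = 1\<close> the equation is linear and is solved with the integrating factor \<open>e^z\<close>.

  For \<open>n \<ge> 2\<close> divide by an \<open>n\<close>-th root of the right-hand side: with
  \<open>f = u e^((\<alpha>z+\<beta>)/n)\<close> and \<open>v = u' + (\<alpha>/n) u\<close>, the equation says that the entire pair \<open>(u, v)\<close>
  lies on the Fermat curve \<open>u^n + v^n = 1\<close> (\<open>solution_normalized\<close>).  A constant \<open>u = d\<close> gives \<open>v = (\<alpha>/n) d\<close>
  and so exactly the condition \<open>d^n (1 + (\<alpha>/n)^n) = 1\<close>; what remains is to find the nonconstant \<open>u\<close>.

  If \<open>n \<ge> 3\<close> there are none (\<open>entire_Fermat_imp_const\<close>): the linear factors \<open>u - w v\<close> of \<open>u^n + v^n\<close>
  have no zeros, and any three of them are linearly dependent, so the quotient of two of them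
  omits two values and is constant by Picard's little theorem.

  If \<open>n = 2\<close> there are only two linear factors, and the curve is parametrized by the
  zero-free entire function \<open>A = u + iv\<close> with \<open>u - iv = 1/A\<close>.  Now the relation between \<open>u'\<close> and
  \<open>v\<close> has to be used; with \<open>a = \<alpha>/2\<close> it becomes
  \<open>(A' + iA)(A^2 - 1) = -aA(A^2 + 1)\<close>.  If \<open>a \<noteq> 0\<close>, then \<open>A\<close> omits \<open>1\<close> besides \<open>0\<close> and is constant, again by
  Picard.  If \<open>a = 0\<close>, one of the two factors on the left vanishes identically, so that
  \<open>A\<close> is constant or a multiple of \<open>e^(-iz)\<close>; the latter is the sine solution
  (\<open>entire_quadratic_cases\<close>).
\<close>

section \<open>Solutions have no poles\<close>

text \<open>
  Dividing the equation by \<open>f^n\<close> gives \<open>(f'/f)^n = e^(\<alpha>w+\<beta>)/f^n - 1\<close>.  At a pole of \<open>f\<close> the right-hand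
  side tends to \<open>-1\<close>, whereas \<open>f'/f\<close> has a pole there.
\<close>
lemma solution_no_pole:
  assumes sol: "meromorphic_solution n \<alpha> \<beta> f" and n: "n \<ge> 1"
  shows "\<not> is_pole f z"
proof
  assume pole: "is_pole f z"
  have mero: "f meromorphic_on UNIV"
    and eq: "\<And>w. \<not> is_pole f w \<Longrightarrow> f w ^ n + deriv f w ^ n = exp (\<alpha> * w + \<beta>)"
    using sol by (auto simp: meromorphic_solution_def nicely_meromorphic_on_def)
  obtain F where F: "(\<lambda>w. f (z + w)) has_laurent_expansion F"
    using mero by (auto simp: meromorphic_on_def)
  have "F \<noteq> 0"
    using has_laurent_expansion_imp_is_pole_iff[OF F] pole by auto
  hence pole': "is_pole (\<lambda>w. deriv f w / f w) z"
    using is_pole_deriv_divide_iff[OF F] pole by simp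
  have "filterlim (\<lambda>w. (deriv f w / f w) ^ n) at_infinity (at z)"
    by (rule Limits.filterlim_power_at_infinity) (use pole' n in \<open>auto simp: is_pole_def\<close>)
  moreover have "((\<lambda>w. (deriv f w / f w) ^ n) \<longlongrightarrow> -1) (at z)"
  proof -
    have "filterlim (\<lambda>w. f w ^ n) at_infinity (at z)"
      by (rule Limits.filterlim_power_at_infinity) (use pole n in \<open>auto simp: is_pole_def\<close>)
    hence "((\<lambda>w. inverse (f w ^ n)) \<longlongrightarrow> 0) (at z)"
      using filterlim_compose[OF tendsto_inverse_0] by blast
    hence "((\<lambda>w. exp (\<alpha> * w + \<beta>) * inverse (f w ^ n) - 1) \<longlongrightarrow> exp (\<alpha> * z + \<beta>) * 0 - 1) (at z)"
      by (intro tendsto_intros)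
    moreover have "\<forall>\<^sub>F w in at z. exp (\<alpha> * w + \<beta>) * inverse (f w ^ n) - 1 = (deriv f w / f w) ^ n"
    proof -
      have "\<forall>\<^sub>F w in at z. \<not> is_pole f w"
        by (rule eventually_not_pole)
          (use mero meromorphic_on_isolated_singularity meromorphic_on_subset in blast)
      moreover have "\<forall>\<^sub>F w in at z. f w \<noteq> 0"
        using pole by (rule non_zero_neighbour_pole)
      ultimately show ?thesis
      proof eventually_elim
        case (elim w)
        show ?case
          unfolding eq[OF elim(1), symmetric] using elim(2) by (simp add: field_simps)
      qed
    qed
    ultimately show ?thesis
      using Lim_transform_eventually by fastforce
  qed
  ultimately show False
    using not_tendsto_and_filterlim_at_infinity[of "at z"] by simp
qed

lemma meromorphic_solution_iff_entire:
  assumes n: "n \<ge> 1"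
  shows "meromorphic_solution n \<alpha> \<beta> f \<longleftrightarrow>
    f holomorphic_on UNIV \<and> (\<forall>z. f z ^ n + deriv f z ^ n = exp (\<alpha> * z + \<beta>))"
proof (intro iffI conjI)
  assume sol: "meromorphic_solution n \<alpha> \<beta> f"
  note np = solution_no_pole[OF sol n]
  have "f analytic_on {z}" for z
    using sol nicely_meromorphic_on_imp_analytic_at[of f UNIV z] np
    by (auto simp: meromorphic_solution_def)
  thus "f holomorphic_on UNIV"
    using analytic_on_analytic_at analytic_imp_holomorphic by blast
  show "\<forall>z. f z ^ n + deriv f z ^ n = exp (\<alpha> * z + \<beta>)"
    using sol np by (auto simp: meromorphic_solution_def)
next
  assume "f holomorphic_on UNIV \<and> (\<forall>z. f z ^ n + deriv f z ^ n = exp (\<alpha> * z + \<beta>))"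
  thus "meromorphic_solution n \<alpha> \<beta> f"
    by (auto simp: meromorphic_solution_def analytic_on_open
        intro!: analytic_on_imp_nicely_meromorphic_on)
qed

lemma meromorphic_solutionI:
  assumes "n \<ge> 1" and "\<And>z. (f has_field_derivative f' z) (at z)"
    and "\<And>z. f z ^ n + f' z ^ n = exp (\<alpha> * z + \<beta>)"
  shows "meromorphic_solution n \<alpha> \<beta> f"
  using assms DERIV_imp_deriv[OF assms(2)]
  by (auto simp: meromorphic_solution_iff_entire intro: holomorphic_on_open[THEN iffD2])

section \<open>Entire functions forced to be constant\<close>

lemma DERIV_zero_imp_const:
  fixes f :: "complex \<Rightarrow> complex"
  assumes "\<And>z. (f has_field_derivative 0) (at z)"
  obtains c where "f = (\<lambda>z. c)"
  using has_field_derivative_zero_constant[of UNIV f] assms by auto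

lemma entire_power_const_imp_const:
  assumes hol: "f holomorphic_on UNIV" and n: "n \<ge> 1" and eq: "\<And>z. f z ^ n = c"
  obtains d where "f = (\<lambda>z. d)"
proof (cases "c = 0")
  case True
  with eq n have "f = (\<lambda>z. 0)" by auto
  thus ?thesis using that by blast
next
  case False
  have "(f has_field_derivative 0) (at z)" for z
  proof -
    have D: "(f has_field_derivative deriv f z) (at z)"
      using hol by (simp add: holomorphic_derivI)
    have "((\<lambda>z. f z ^ n) has_field_derivative of_nat n * f z ^ (n - 1) * deriv f z) (at z)"
      by (rule derivative_eq_intros D refl)+ simp
    moreover have "((\<lambda>z. f z ^ n) has_field_derivative 0) (at z)"
      by (simp add: eq)
    ultimately have "of_nat n * f z ^ (n - 1) * deriv f z = 0"
      by (rule DERIV_unique)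
    moreover have "f z \<noteq> 0"
      using eq[of z] False n by auto
    ultimately have "deriv f z = 0" using n by simp
    thus ?thesis using D by simp
  qed
  thus ?thesis using DERIV_zero_imp_const that by blast
qed

text \<open>
  If \<open>p\<close>, \<open>q\<close>, \<open>r\<close> are distinct solutions of \<open>w^n = -1\<close>, then \<open>u - p v\<close>, \<open>u - q v\<close> and \<open>u - r v\<close> have no
  zeros, because \<open>u = w v\<close> would make \<open>u^n + v^n\<close> vanish.  So \<open>(u - p v)/(u - q v)\<close> omits \<open>0\<close>, and
  it also omits \<open>(r - p)/(r - q)\<close>, the value that it would take where \<open>u = r v\<close>.  Once
  it is constant, \<open>u\<close> and \<open>v\<close> are both constant multiples of \<open>u - q v\<close>, and the equation fixes
  the \<open>n\<close>-th power of that function.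
\<close>
lemma entire_Fermat_imp_const:
  assumes u: "u holomorphic_on UNIV" and v: "v holomorphic_on UNIV"
    and n: "n \<ge> 3" and eq: "\<And>z. u z ^ n + v z ^ n = 1"
  obtains d where "u = (\<lambda>z. d)"
proof -
  have "3 \<le> card {w::complex. w ^ n = -1}"
    using n by (simp add: card_nth_roots)
  then obtain T where T: "T \<subseteq> {w::complex. w ^ n = -1}" "card T = 3"
    by (meson obtain_subset_with_card_n)
  then obtain p q r :: complex where pqr: "p ^ n = -1" "q ^ n = -1" "r ^ n = -1" "p \<noteq> q" "q \<noteq> r" "p \<noteq> r"
    unfolding card_3_iff by blast
  have nz: "u z \<noteq> w * v z" if "w ^ n = -1" for w z
  proof
    assume "u z = w * v z"
    with eq[of z] that show False by (simp add: power_mult_distrib)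
  qed
  define h where "h = (\<lambda>z. (u z - p * v z) / (u z - q * v z))"
  define m where "m = (r - p) / (r - q)"
  have "h holomorphic_on UNIV"
    unfolding h_def using nz[OF pqr(2)] by (intro holomorphic_intros u v) auto
  moreover have "0 \<noteq> m" using pqr by (simp add: m_def)
  moreover have "range h \<inter> {0, m} = {}"
  proof -
    have "h z \<noteq> 0" for z
      using nz[OF pqr(1)] nz[OF pqr(2)] by (simp add: h_def)
    moreover have "h z \<noteq> m" for z
    proof
      assume "h z = m"
      hence "(u z - p * v z) * (r - q) = (r - p) * (u z - q * v z)"
        using nz[OF pqr(2), of z] pqr by (simp add: h_def m_def frac_eq_eq)
      hence "(p - q) * (u z - r * v z) = 0" by algebra
      thus False using nz[OF pqr(3), of z] pqr by simp
    qed
    ultimately show ?thesis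
      by (intro equals0I) (elim IntE imageE insertE emptyE; simp)
  qed
  ultimately obtain k where k: "h = (\<lambda>z. k)"
    using little_Picard[of h 0 m] by metis
  define C where "C = (\<lambda>z. u z - q * v z)"
  have C: "C holomorphic_on UNIV"
    unfolding C_def by (intro holomorphic_intros u v)
  \<comment> \<open>\<open>s\<close> and \<open>t\<close> come from solving \<open>u - p v = k C\<close>, \<open>u - q v = C\<close> for \<open>u = s C\<close> and \<open>v = t C\<close>\<close>
  define s t where "s = (k * q - p) / (q - p)" and "t = (k - 1) / (q - p)"
  have kC: "u z - p * v z = k * C z" for z
    using fun_cong[OF k, of z] nz[OF pqr(2), of z] by (simp add: h_def C_def field_simps)
  have vt: "v z = t * C z" for z
  proof -
    have "(q - p) * v z = (k - 1) * C z"
      using kC[of z] unfolding C_def by algebra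
    thus ?thesis using pqr(4) by (simp add: t_def field_simps)
  qed
  have us: "u z = s * C z" for z
  proof -
    have "(q - p) * u z = (k * q - p) * C z"
      using kC[of z] unfolding C_def by algebra
    thus ?thesis using pqr(4) by (simp add: s_def field_simps)
  qed
  have "(s ^ n + t ^ n) * C z ^ n = 1" for z
    using eq[of z] by (simp add: us vt power_mult_distrib ring_distribs)
  hence "C z ^ n = 1 / (s ^ n + t ^ n)" for z
    by (metis mult_eq_0_iff nonzero_eq_divide_eq mult.commute zero_neq_one)
  then obtain c where "C = (\<lambda>z. c)"
    using n by (auto intro: entire_power_const_imp_const[OF C, of n])
  thus ?thesis using us that[of "s * c"] by auto
qed

section \<open>The quadratic equation\<close>

text \<open>
  The conic \<open>u^2 + v^2 = 1\<close> is parametrized by \<open>u = (A + 1/A)/2\<close>, \<open>v = (A - 1/A)/(2i)\<close>, and the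
  definition of \<open>v\<close> in terms of \<open>u\<close> turns into a first-order equation for \<open>A\<close>, called \<open>ode\<close> below.
  Its right-hand side vanishes for \<open>a = 0\<close>; for \<open>a \<noteq> 0\<close> it prevents \<open>A^2 = 1\<close>.
\<close>
lemma entire_quadratic_cases:
  assumes u: "u holomorphic_on UNIV"
    and eq: "\<And>z. u z ^ 2 + (deriv u z + a * u z) ^ 2 = 1"
  shows "(\<exists>d. u = (\<lambda>z. d)) \<or> a = 0 \<and> (\<exists>b. u = (\<lambda>z. sin (z + b)))"
proof -
  define v where "v = (\<lambda>z. deriv u z + a * u z)"
  define A where "A = (\<lambda>z. u z + \<i> * v z)"
  define B where "B = (\<lambda>z. u z - \<i> * v z)"
  have v: "v holomorphic_on UNIV"
    unfolding v_def using u by (intro holomorphic_intros) auto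
  have A: "A holomorphic_on UNIV"
    unfolding A_def by (intro holomorphic_intros u v)
  have AB: "A z * B z = 1" for z
    using eq[of z] by (simp add: A_def B_def v_def algebra_simps power2_eq_square)
  have A0: "A z \<noteq> 0" for z using AB[of z] by auto
  have uA: "u z = (A z + inverse (A z)) / 2" for z
    using AB[of z] A0[of z] inverse_unique[OF AB, of z] by (simp add: A_def B_def)
  have vA: "v z = - \<i> * (A z - inverse (A z)) / 2" for z
    using inverse_unique[OF AB, of z] by (simp add: A_def B_def)
  have ode: "(deriv A z + \<i> * A z) * (A z ^ 2 - 1) = - a * A z * (A z ^ 2 + 1)" for z
  proof -
    have DA: "(A has_field_derivative deriv A z) (at z)"
      using A by (simp add: holomorphic_derivI)
    have "((\<lambda>z. (A z + inverse (A z)) / 2) has_field_derivative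
            (deriv A z - deriv A z * inverse (A z) ^ 2) / 2) (at z)"
      by (rule derivative_eq_intros DA refl A0)+ (simp_all add: power2_eq_square field_simps)
    hence "deriv u z = (deriv A z - deriv A z * inverse (A z) ^ 2) / 2"
      using uA by (metis (no_types, lifting) DERIV_imp_deriv ext)
    hence "(deriv A z - deriv A z * inverse (A z) ^ 2) / 2 + a * (A z + inverse (A z)) / 2
             = - \<i> * (A z - inverse (A z)) / 2"
      using vA[of z] uA[of z] by (simp only: v_def times_divide_eq_right)
    hence "(deriv A z - deriv A z * inverse (A z) ^ 2 + a * (A z + inverse (A z))) / 2
             = - \<i> * (A z - inverse (A z)) / 2"
      by (simp only: add_divide_distrib[of "deriv A z - deriv A z * inverse (A z) ^ 2"])
    hence "deriv A z - deriv A z * inverse (A z) ^ 2 + a * (A z + inverse (A z))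
             = - \<i> * (A z - inverse (A z))"
      by simp
    moreover have "A z * inverse (A z) = 1" using A0 by simp
    ultimately show ?thesis by algebra
  qed
  have const: "\<exists>d. u = (\<lambda>z. d)" if "A = (\<lambda>z. c)" for c
  proof -
    have "u = (\<lambda>z. (c + inverse c) / 2)"
      by (rule ext) (simp only: uA that)
    thus ?thesis by blast
  qed
  show ?thesis
  proof (cases "a = 0")
    case False
    have "A z \<noteq> 1" for z
    proof
      assume "A z = 1" with ode[of z] False show False by simp
    qed
    hence "range A \<inter> {0, 1} = {}"
      using A0 by (intro equals0I) (elim IntE imageE insertE emptyE; simp)
    then obtain c where "A = (\<lambda>z. c)"
      using little_Picard[OF A, of 0 1] by auto
    thus ?thesis using const by blast
  next
    case True
    show ?thesis
    proof (cases "\<forall>z. A z ^ 2 = 1")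
      case True
      then obtain c where "A = (\<lambda>z. c)"
        using entire_power_const_imp_const[OF A, of 2 1] by auto
      thus ?thesis using const by blast
    next
      case False
      \<comment> \<open>the other factor vanishes on the nonempty open set \<open>S\<close>, hence everywhere\<close>
      then obtain z0 where z0: "A z0 ^ 2 \<noteq> 1" by blast
      define S where "S = {z. A z ^ 2 \<noteq> 1}"
      have "continuous_on UNIV A" using A by (rule holomorphic_on_imp_continuous_on)
      hence "open S"
        unfolding S_def by (intro open_Collect_neq continuous_intros) auto
      have "deriv A z + \<i> * A z = 0" for z
      proof (rule analytic_continuation_open[of S UNIV "\<lambda>z. deriv A z + \<i> * A z" "\<lambda>_. 0"])
        show "(\<lambda>z. deriv A z + \<i> * A z) holomorphic_on UNIV"
          using A by (intro holomorphic_intros) auto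
        show "deriv A z + \<i> * A z = 0" if "z \<in> S" for z
          using that ode[of z] \<open>a = 0\<close> by (simp add: S_def)
      qed (use \<open>open S\<close> z0 in \<open>auto simp: S_def\<close>)
      hence dA: "deriv A z = - \<i> * A z" for z
        by (simp add: eq_neg_iff_add_eq_0)
      have "((\<lambda>z. A z * exp (\<i> * z)) has_field_derivative 0) (at z)" for z
      proof -
        have DA: "(A has_field_derivative - \<i> * A z) (at z)"
          using A by (metis UNIV_I dA holomorphic_derivI open_UNIV)
        show ?thesis
          by (rule derivative_eq_intros DA refl)+ (simp add: algebra_simps)
      qed
      then obtain c where c: "(\<lambda>z. A z * exp (\<i> * z)) = (\<lambda>z. c)"
        by (rule DERIV_zero_imp_const)
      have Ac: "A z = c * exp (- (\<i> * z))" for z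
        using fun_cong[OF c, of z] by (simp add: exp_minus field_simps)
      hence "c \<noteq> 0" using A0[of 0] by auto
      \<comment> \<open>\<open>b\<close> is chosen so that \<open>e^(-ib) = c/i\<close>, which matches the \<open>e^(-iz)\<close> terms of \<open>sin (z + b)\<close> and \<open>u\<close>\<close>
      define b where "b = \<i> * Ln (c / \<i>)"
      have eb: "exp (\<i> * b) = \<i> / c" "exp (- (\<i> * b)) = c / \<i>"
        using \<open>c \<noteq> 0\<close> by (simp_all add: b_def exp_minus divide_inverse flip: mult.assoc)
      have "u z = sin (z + b)" for z
      proof -
        have "sin (z + b) = (exp (\<i> * z) * exp (\<i> * b) - exp (- (\<i> * z)) * exp (- (\<i> * b))) / (2 * \<i>)"
          by (simp add: sin_exp_eq ring_distribs flip: exp_add)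
        also have "\<dots> = u z"
          unfolding eb uA Ac using \<open>c \<noteq> 0\<close> by (simp add: exp_minus field_simps)
        finally show ?thesis by simp
      qed
      thus ?thesis using \<open>a = 0\<close> by blast
    qed
  qed
qed

section \<open>Removing the exponential right-hand side\<close>

lemma exp_divide_power:
  fixes w :: complex
  assumes "n \<ge> 1"
  shows "exp (w / of_nat n) ^ n = exp w"
  using assms by (simp flip: exp_of_nat_mult)

lemma solution_normalized:
  assumes sol: "meromorphic_solution n \<alpha> \<beta> f" and n: "n \<ge> 1"
  obtains u where "u holomorphic_on UNIV"
    and "\<And>z. u z ^ n + (deriv u z + \<alpha> / of_nat n * u z) ^ n = 1"
    and "f = (\<lambda>z. u z * exp ((\<alpha> * z + \<beta>) / of_nat n))"
proof -
  have f: "f holomorphic_on UNIV" and eq: "\<And>z. f z ^ n + deriv f z ^ n = exp (\<alpha> * z + \<beta>)"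
    using sol n by (auto simp: meromorphic_solution_iff_entire)
  define E where "E = (\<lambda>z. exp ((\<alpha> * z + \<beta>) / of_nat n))"
  define u where "u = (\<lambda>z. f z / E z)"
  have E0: "E z \<noteq> 0" for z by (simp add: E_def)
  have En: "E z ^ n = exp (\<alpha> * z + \<beta>)" for z
    using n by (simp add: E_def exp_divide_power)
  have DE: "(E has_field_derivative \<alpha> / of_nat n * E z) (at z)" for z
    unfolding E_def by (rule derivative_eq_intros refl | use n in simp)+
  have uhol: "u holomorphic_on UNIV"
    unfolding u_def E_def by (intro holomorphic_intros f) (use n in auto)
  have fu: "f z = u z * E z" for z by (simp add: u_def E0)
  have du: "deriv f z = (deriv u z + \<alpha> / of_nat n * u z) * E z" for z
  proof -
    have Du: "(u has_field_derivative deriv u z) (at z)"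
      using uhol by (simp add: holomorphic_derivI)
    from DERIV_mult[OF Du DE[of z]]
    have "((\<lambda>z. u z * E z) has_field_derivative (deriv u z + \<alpha> / of_nat n * u z) * E z) (at z)"
      by (simp add: algebra_simps)
    thus ?thesis using fu by (metis (no_types, lifting) DERIV_imp_deriv ext)
  qed
  have "u z ^ n + (deriv u z + \<alpha> / of_nat n * u z) ^ n = 1" for z
  proof -
    have "(u z ^ n + (deriv u z + \<alpha> / of_nat n * u z) ^ n) * E z ^ n = 1 * E z ^ n"
      using eq[of z] unfolding fu du En[symmetric] by (simp only: power_mult_distrib distrib_right[of "u z ^ n"] mult_1)
    thus ?thesis using E0[of z] by (simp only: mult_cancel_right) simp
  qed
  thus ?thesis using that uhol fu unfolding E_def by blast
qed

lemma exponential_solution_iff: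
  assumes n: "n \<ge> 1"
  shows "meromorphic_solution n \<alpha> \<beta> (\<lambda>z. d * exp ((\<alpha> * z + \<beta>) / of_nat n)) \<longleftrightarrow>
    d ^ n * (1 + (\<alpha> / of_nat n) ^ n) = 1"
proof -
  let ?f = "\<lambda>z. d * exp ((\<alpha> * z + \<beta>) / of_nat n)"
  have D: "(?f has_field_derivative \<alpha> / of_nat n * ?f z) (at z)" for z
    by (rule derivative_eq_intros refl | use n in simp)+
  have "?f holomorphic_on UNIV"
    by (intro holomorphic_intros) (use n in auto)
  moreover have "?f z ^ n + (\<alpha> / of_nat n * ?f z) ^ n =
      d ^ n * (1 + (\<alpha> / of_nat n) ^ n) * exp (\<alpha> * z + \<beta>)" for z
    using n by (simp only: power_mult_distrib exp_divide_power) (simp add: algebra_simps)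
  ultimately show ?thesis
    by (simp only: meromorphic_solution_iff_entire[OF n] DERIV_imp_deriv[OF D]
        mult_cancel_right2 exp_not_eq_zero simp_thms)
qed

section \<open>The solutions for each exponent\<close>

text \<open>
  For \<open>n = 1\<close> the equation reads \<open>(f e^z)' = e^((\<alpha>+1)z+\<beta>)\<close>, so the solutions are determined by a
  primitive \<open>G\<close> of the right-hand side.  The form of \<open>G\<close> changes at \<open>\<alpha> = -1\<close>, where the right-hand
  side is constant; this is the only difference between the two cases.
\<close>
lemma linear_solution_obtain:
  assumes sol: "meromorphic_solution 1 \<alpha> \<beta> f"
    and G: "\<And>z. (G has_field_derivative exp ((\<alpha> + 1) * z + \<beta>)) (at z)"
  obtains a where "f = (\<lambda>z. (G z + a) * exp (- z))"
proof -
  have f: "f holomorphic_on UNIV" and eq: "\<And>z. f z + deriv f z = exp (\<alpha> * z + \<beta>)"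
    using sol by (auto simp: meromorphic_solution_iff_entire)
  have "((\<lambda>z. f z * exp z - G z) has_field_derivative 0) (at z)" for z
  proof -
    have "(f has_field_derivative deriv f z) (at z)"
      using f by (simp add: holomorphic_derivI)
    from DERIV_diff[OF DERIV_mult[OF this DERIV_exp] G]
    have "((\<lambda>z. f z * exp z - G z) has_field_derivative
       (f z + deriv f z) * exp z - exp ((\<alpha> + 1) * z + \<beta>)) (at z)"
      by (simp add: algebra_simps)
    thus ?thesis by (simp add: eq algebra_simps flip: exp_add)
  qed
  then obtain a where a: "(\<lambda>z. f z * exp z - G z) = (\<lambda>z. a)"
    by (rule DERIV_zero_imp_const)
  have "f z = (G z + a) * exp (- z)" for z
    using fun_cong[OF a, of z] by (simp add: exp_minus field_simps)
  thus ?thesis using that by blast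
qed

lemma linear_solution_iff:
  assumes G: "\<And>z. (G has_field_derivative exp ((\<alpha> + 1) * z + \<beta>)) (at z)"
  shows "meromorphic_solution 1 \<alpha> \<beta> f \<longleftrightarrow> (\<exists>a. f = (\<lambda>z. (G z + a) * exp (- z)))"
proof
  assume "\<exists>a. f = (\<lambda>z. (G z + a) * exp (- z))"
  then obtain a where f: "f = (\<lambda>z. (G z + a) * exp (- z))" by blast
  have "(f has_field_derivative exp (\<alpha> * z + \<beta>) - f z) (at z)" for z
    unfolding f by (rule derivative_eq_intros G refl)+ (simp add: algebra_simps flip: exp_add)
  thus "meromorphic_solution 1 \<alpha> \<beta> f"
    by (rule meromorphic_solutionI[rotated]) auto
qed (blast elim: linear_solution_obtain[OF _ G])

lemma linear_solutions_nonresonant: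
  assumes "\<alpha> \<noteq> -1"
  shows "meromorphic_solution 1 \<alpha> \<beta> f \<longleftrightarrow>
    (\<exists>a. f = (\<lambda>z. exp (\<alpha> * z + \<beta>) / (\<alpha> + 1) + a * exp (- z)))"
proof -
  have \<alpha>: "\<alpha> + 1 \<noteq> 0" using assms by (simp add: add_eq_0_iff2)
  have "((\<lambda>z. exp ((\<alpha> + 1) * z + \<beta>) / (\<alpha> + 1)) has_field_derivative
      exp ((\<alpha> + 1) * z + \<beta>)) (at z)" for z
    by (rule derivative_eq_intros refl | use \<alpha> in simp)+
  note linear_solution_iff[OF this, of f]
  moreover have "(exp ((\<alpha> + 1) * z + \<beta>) / (\<alpha> + 1) + a) * exp (- z) =
      exp (\<alpha> * z + \<beta>) / (\<alpha> + 1) + a * exp (- z)" for a z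
    by (simp add: algebra_simps add_divide_distrib flip: exp_add)
  ultimately show ?thesis by simp
qed

lemma linear_solutions_resonant:
  "meromorphic_solution 1 (-1) \<beta> f \<longleftrightarrow>
    (\<exists>a. f = (\<lambda>z. z * exp (- z + \<beta>) + a * exp (- z)))"
proof -
  have "((\<lambda>z. z * exp \<beta>) has_field_derivative exp ((-1 + 1) * z + \<beta>)) (at z)" for z
    by (rule derivative_eq_intros refl | simp)+
  note linear_solution_iff[OF this, of f]
  moreover have "(z * exp \<beta> + a) * exp (- z) = z * exp (- z + \<beta>) + a * exp (- z)" for a z
    by (simp only: exp_add) (simp add: algebra_simps)
  ultimately show ?thesis by simp
qed

lemma sine_solution:
  "meromorphic_solution 2 0 \<beta> (\<lambda>z. exp (\<beta> / 2) * sin (z + b))"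
proof (rule meromorphic_solutionI)
  show "((\<lambda>z. exp (\<beta> / 2) * sin (z + b)) has_field_derivative exp (\<beta> / 2) * cos (z + b)) (at z)" for z
    by (rule derivative_eq_intros refl | simp)+
  show "(exp (\<beta> / 2) * sin (z + b)) ^ 2 + (exp (\<beta> / 2) * cos (z + b)) ^ 2 = exp (0 * z + \<beta>)" for z
  proof -
    have "(exp (\<beta> / 2) * sin (z + b)) ^ 2 + (exp (\<beta> / 2) * cos (z + b)) ^ 2 =
        exp (\<beta> / 2) ^ 2 * (sin (z + b) ^ 2 + cos (z + b) ^ 2)"
      by (simp only: power_mult_distrib ring_distribs)
    also have "\<dots> = exp \<beta>"
      by (simp flip: exp_double)
    finally show ?thesis by simp
  qed
qed simp

lemma quadratic_solutions:
  "meromorphic_solution 2 \<alpha> \<beta> f \<longleftrightarrow>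
    (\<exists>d. d ^ 2 * (1 + (\<alpha> / 2) ^ 2) = 1 \<and> f = (\<lambda>z. d * exp ((\<alpha> * z + \<beta>) / 2))) \<or>
    \<alpha> = 0 \<and> (\<exists>b. f = (\<lambda>z. exp (\<beta> / 2) * sin (z + b)))" (is "_ \<longleftrightarrow> ?exp \<or> ?sin")
proof
  assume sol: "meromorphic_solution 2 \<alpha> \<beta> f"
  from solution_normalized[OF sol] obtain u where u: "u holomorphic_on UNIV"
    "\<And>z. u z ^ 2 + (deriv u z + \<alpha> / 2 * u z) ^ 2 = 1"
    "f = (\<lambda>z. u z * exp ((\<alpha> * z + \<beta>) / 2))" by auto
  from entire_quadratic_cases[OF u(1,2)] show "?exp \<or> ?sin"
  proof
    assume "\<exists>d. u = (\<lambda>z. d)"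
    then obtain d where "f = (\<lambda>z. d * exp ((\<alpha> * z + \<beta>) / 2))" using u(3) by auto
    thus ?thesis using exponential_solution_iff[of 2 \<alpha> \<beta> d] sol by auto
  next
    assume "\<alpha> / 2 = 0 \<and> (\<exists>b. u = (\<lambda>z. sin (z + b)))"
    thus ?thesis using u(3) by (auto simp: mult.commute)
  qed
next
  assume "?exp \<or> ?sin"
  thus "meromorphic_solution 2 \<alpha> \<beta> f"
    using exponential_solution_iff[of 2 \<alpha> \<beta>] sine_solution by auto
qed

lemma higher_solutions:
  assumes n: "n \<ge> 3"
  shows "meromorphic_solution n \<alpha> \<beta> f \<longleftrightarrow>
    (\<exists>d. d ^ n * (1 + (\<alpha> / of_nat n) ^ n) = 1 \<and> f = (\<lambda>z. d * exp ((\<alpha> * z + \<beta>) / of_nat n)))"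
proof
  have n1: "n \<ge> 1" using n by simp
  assume sol: "meromorphic_solution n \<alpha> \<beta> f"
  then obtain u where u: "u holomorphic_on UNIV"
    "\<And>z. u z ^ n + (deriv u z + \<alpha> / of_nat n * u z) ^ n = 1"
    "f = (\<lambda>z. u z * exp ((\<alpha> * z + \<beta>) / of_nat n))" using solution_normalized n1 by blast
  have "(\<lambda>z. deriv u z + \<alpha> / of_nat n * u z) holomorphic_on UNIV"
    using u(1) n1 by (intro holomorphic_intros) auto
  then obtain d where "u = (\<lambda>z. d)"
    using entire_Fermat_imp_const[OF u(1) _ n u(2)] by blast
  hence f: "f = (\<lambda>z. d * exp ((\<alpha> * z + \<beta>) / of_nat n))" using u(3) by simp
  thus "\<exists>d. d ^ n * (1 + (\<alpha> / of_nat n) ^ n) = 1 \<and> f = (\<lambda>z. d * exp ((\<alpha> * z + \<beta>) / of_nat n))"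
    using exponential_solution_iff[OF n1, of \<alpha> \<beta> d] sol by auto
next
  have n1: "n \<ge> 1" using n by simp
  assume "\<exists>d. d ^ n * (1 + (\<alpha> / of_nat n) ^ n) = 1 \<and> f = (\<lambda>z. d * exp ((\<alpha> * z + \<beta>) / of_nat n))"
  thus "meromorphic_solution n \<alpha> \<beta> f"
    using exponential_solution_iff[OF n1] by auto
qed

theorem theorem2:
  fixes n :: nat and \<alpha> \<beta> :: complex
  assumes "n \<ge> 1"
  shows "(\<forall>f. meromorphic_solution n \<alpha> \<beta> f \<longrightarrow> f holomorphic_on UNIV) \<and>
    (n = 1 \<longrightarrow>
      (\<alpha> \<noteq> -1 \<longrightarrow>
        {f. meromorphic_solution n \<alpha> \<beta> f} =
        {f. \<exists>a. f = (\<lambda>z. exp (\<alpha> * z + \<beta>) / (\<alpha> + 1) + a * exp (- z))}) \<and>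
      (\<alpha> = -1 \<longrightarrow>
        {f. meromorphic_solution n \<alpha> \<beta> f} =
        {f. \<exists>a. f = (\<lambda>z. z * exp (- z + \<beta>) + a * exp (- z))})) \<and>
    (n = 2 \<longrightarrow>
      {f. meromorphic_solution n \<alpha> \<beta> f} =
      {f. \<exists>d. d ^ 2 * (1 + (\<alpha> / 2) ^ 2) = 1 \<and> f = (\<lambda>z. d * exp ((\<alpha> * z + \<beta>) / 2))} \<union>
      {f. \<alpha> = 0 \<and> (\<exists>b. f = (\<lambda>z. exp (\<beta> / 2) * sin (z + b)))}) \<and>
    (n \<ge> 3 \<longrightarrow>
      {f. meromorphic_solution n \<alpha> \<beta> f} =
      {f. \<exists>d. d ^ n * (1 + (\<alpha> / of_nat n) ^ n) = 1 \<and>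
              f = (\<lambda>z. d * exp ((\<alpha> * z + \<beta>) / of_nat n))})"
proof (intro conjI impI allI)
  show "f holomorphic_on UNIV" if "meromorphic_solution n \<alpha> \<beta> f" for f
    using that assms by (simp add: meromorphic_solution_iff_entire)
next
  assume "n = 1" "\<alpha> \<noteq> -1"
  thus "{f. meromorphic_solution n \<alpha> \<beta> f} =
      {f. \<exists>a. f = (\<lambda>z. exp (\<alpha> * z + \<beta>) / (\<alpha> + 1) + a * exp (- z))}"
    by (simp only: linear_solutions_nonresonant not_False_eq_True)
next
  assume "n = 1" "\<alpha> = -1"
  thus "{f. meromorphic_solution n \<alpha> \<beta> f} =
      {f. \<exists>a. f = (\<lambda>z. z * exp (- z + \<beta>) + a * exp (- z))}"
    by (simp only: linear_solutions_resonant)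
next
  assume "n = 2"
  thus "{f. meromorphic_solution n \<alpha> \<beta> f} =
      {f. \<exists>d. d ^ 2 * (1 + (\<alpha> / 2) ^ 2) = 1 \<and> f = (\<lambda>z. d * exp ((\<alpha> * z + \<beta>) / 2))} \<union>
      {f. \<alpha> = 0 \<and> (\<exists>b. f = (\<lambda>z. exp (\<beta> / 2) * sin (z + b)))}"
    by (simp only: quadratic_solutions Collect_disj_eq)
next
  assume "n \<ge> 3"
  thus "{f. meromorphic_solution n \<alpha> \<beta> f} =
      {f. \<exists>d. d ^ n * (1 + (\<alpha> / of_nat n) ^ n) = 1 \<and>
              f = (\<lambda>z. d * exp ((\<alpha> * z + \<beta>) / of_nat n))}"
    by (simp only: higher_solutions)
qed

end
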